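(* Let $X$ be a compact metric space, let $f:X\to X$ be a continuous map with the gluing orbit property, let $d\ge1$ and let $\varphi:X\to\mathbb R^d$ be continuous. Then: (1) either there is $v\in\mathbb R^d$ such that $\lim_{n\to\infty}\frac1n\sum_{j=0}^{n-1}\varphi(f^j(x))=v$ for all $x\in X$; (2) or the set $X_{\varphi,f}$ of points $x\in X$ such that the sequence $\big(\frac1n\sum_{j=0}^{n-1}\varphi(f^j(x))\big)_{n\ge1}$ accumulates in a non-trivial connected subset of $\mathbb R^d$ is Baire residual in $X$. Moreover, if $X_{\varphi,f}\ne\emptyset$ then $\mathcal V_\varphi$ is connected and the set of points with wild historic behavior is a Baire residual subset of $X$.
   Context: Gluing orbit property: for every $\varepsilon>0$ there is an integer $m=m(\varepsilon)\ge1$ such that for any points $x_1,\dots,x_k\in X$ and positive integers $n_1,\dots,n_k$ there are integers $0\le p_1,\dots,p_{k-1}\le m(\varepsilon)$ and a point $y\in X$ such that $d(f^j(y),f^j(x_1))\le\varepsilon$ for $0\le j\le n_1$ and $d(f^{\,j+n_1+p_1+\cdots+n_{i-1}+p_{i-1}}(y),f^j(x_i))\le\varepsilon$ for every $2\le i\le k$ and $0\le j\le n_i$ (here $d(\cdot,\cdot)$ is the metric of $X$). For $x\in X$, $\mathcal V_\varphi(x)\subset\mathbb R^d$ is the (connected) set of accumulation points of $\big(\frac1n\sum_{j=0}^{n-1}\varphi(f^j(x))\big)_{n\ge1}$, and $\mathcal V_\varphi=\bigcup_{x\in X}\mathcal V_\varphi(x)$. A set of vectors is trivial if it reduces to a single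 vector, non-trivial otherwise; thus $X_{\varphi,f}$ is the set of $x$ for which $\lim_n\frac1n\sum_{j=0}^{n-1}\varphi(f^j(x))$ does not exist (points with historic behavior). When $\mathcal V_\varphi$ is not a single vector, $x\in X$ has wild historic behavior if $\mathcal V_\varphi(x)=\mathcal V_\varphi$. A subset of $X$ is Baire residual if it contains a countable intersection of open and dense subsets of $X$. *)

theory Defs
  imports "HOL-Analysis.Analysis"
begin

text \<open>
  Throughout, the phase space is a subset \<open>X\<close> of a type of class \<^class>\<open>metric_space\<close> with the
  induced metric, and maps of \<open>X\<close> into itself are only constrained on \<open>X\<close>.
\<close>

text \<open>
  The points, lengths and gaps are the values of \<open>x\<close>, \<open>n\<close> at \<open>1, \<dots>, k\<close> and of \<open>p\<close> at
  \<open>1, \<dots>, k - 1\<close>; all other values of these functions are irrelevant.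
\<close>

definition gluing_orbit_property :: "'a::metric_space set \<Rightarrow> ('a \<Rightarrow> 'a) \<Rightarrow> bool" where
  "gluing_orbit_property X f \<longleftrightarrow>
    (\<forall>\<epsilon>>0. \<exists>m::nat. m \<ge> 1 \<and>
      (\<forall>(k::nat) (x :: nat \<Rightarrow> 'a) (n :: nat \<Rightarrow> nat).
        k \<ge> 1 \<longrightarrow> (\<forall>i\<in>{1..k}. x i \<in> X \<and> n i \<ge> 1) \<longrightarrow>
        (\<exists>(p :: nat \<Rightarrow> nat) y. (\<forall>i\<in>{1..<k}. p i \<le> m) \<and> y \<in> X \<and>
          (\<forall>j\<le>n 1. dist ((f ^^ j) y) ((f ^^ j) (x 1)) \<le> \<epsilon>) \<and>
          (\<forall>i\<in>{2..k}. \<forall>j\<le>n i.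
            dist ((f ^^ (j + (\<Sum>l\<in>{1..<i}. n l + p l))) y) ((f ^^ j) (x i)) \<le> \<epsilon>))))"

definition birkhoff_average ::
    "('a \<Rightarrow> 'a) \<Rightarrow> ('a \<Rightarrow> 'b::real_vector) \<Rightarrow> nat \<Rightarrow> 'a \<Rightarrow> 'b" where
  "birkhoff_average f \<phi> n x = (1 / real n) *\<^sub>R (\<Sum>j<n. \<phi> ((f ^^ j) x))"

text \<open>
  Accumulation points are limits of subsequences. The junk value of the average at \<open>n = 0\<close>
  plays no role, because a strictly increasing sequence of indices is positive from its second
  term on.
\<close>

definition accumulation_vectors ::
    "('a \<Rightarrow> 'a) \<Rightarrow> ('a \<Rightarrow> 'b::real_normed_vector) \<Rightarrow> 'a \<Rightarrow> 'b set" where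
  "accumulation_vectors f \<phi> x =
    {v. \<exists>r :: nat \<Rightarrow> nat. strict_mono r \<and> (\<lambda>i. birkhoff_average f \<phi> (r i) x) \<longlonglongrightarrow> v}"

definition all_accumulation_vectors ::
    "'a set \<Rightarrow> ('a \<Rightarrow> 'a) \<Rightarrow> ('a \<Rightarrow> 'b::real_normed_vector) \<Rightarrow> 'b set" where
  "all_accumulation_vectors X f \<phi> = (\<Union>x\<in>X. accumulation_vectors f \<phi> x)"

definition trivial_set :: "'b set \<Rightarrow> bool" where
  "trivial_set V \<longleftrightarrow> (\<exists>v. V = {v})"

definition historic_points ::
    "'a set \<Rightarrow> ('a \<Rightarrow> 'a) \<Rightarrow> ('a \<Rightarrow> 'b::real_normed_vector) \<Rightarrow> 'a set" where
  "historic_points X f \<phi> =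
    {x \<in> X. connected (accumulation_vectors f \<phi> x) \<and> \<not> trivial_set (accumulation_vectors f \<phi> x)}"

definition wild_historic_points ::
    "'a set \<Rightarrow> ('a \<Rightarrow> 'a) \<Rightarrow> ('a \<Rightarrow> 'b::real_normed_vector) \<Rightarrow> 'a set" where
  "wild_historic_points X f \<phi> =
    {x \<in> X. \<not> trivial_set (all_accumulation_vectors X f \<phi>) \<and>
            accumulation_vectors f \<phi> x = all_accumulation_vectors X f \<phi>}"

text \<open>Openness and density are relative to \<open>X\<close>.\<close>

definition baire_residual :: "'a::topological_space set \<Rightarrow> 'a set \<Rightarrow> bool" where
  "baire_residual X R \<longleftrightarrow> R \<subseteq> X \<and>
    (\<exists>U :: nat \<Rightarrow> 'a set.
      (\<forall>n. openin (top_of_set X) (U n) \<and> X \<subseteq> closure (U n)) \<and> (\<Inter>n. U n) \<subseteq> R)"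

end

theory Submission
  imports Defs
begin

text \<open>
  Write \<open>V\<close> for the union of all the sets of accumulation vectors. The point of the proof is that
  a generic orbit sees every vector of \<open>V\<close>. If \<open>v\<close> is an accumulation vector of \<open>x\<close>, then gluing
  one step of an arbitrary orbit to a very long piece of the orbit of \<open>x\<close> produces a point \<open>y\<close>, as
  close as desired to the prescribed one, whose averages come close to \<open>v\<close> at a large time: the
  gap before the piece of \<open>x\<close> has a length bounded independently of the length of the piece, so
  it does not affect the average (\<open>gluing_approximates_accumulation_vector\<close>). Hence the
  points whose averages come \<open>e\<close>-close to \<open>v\<close> after time \<open>N\<close> form an open dense set. Letting \<open>e\<close>
  and \<open>N\<close> vary, and letting \<open>v\<close> run through a countable dense subset of \<open>V\<close>, gives countably many
  open dense sets; since the accumulation vectors of one point form a closed set, every point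
  in their intersection accumulates on all of \<open>V\<close> (\<open>residual_full_accumulation\<close>).

  Everything follows from this. Consecutive averages differ by \<open>O(1/n)\<close>, so the accumulation
  vectors of one point form a connected set (\<open>connected_subsequential_limits\<close>). If \<open>X\<close> is nonempty, by
  Baire's theorem some point has all of \<open>V\<close> as its accumulation set, so \<open>V\<close> is connected. If \<open>V\<close> is a
  single vector, all averages converge to it by compactness; otherwise the generic
  points found above are wild, and in particular historic.
\<close>

section \<open>Limits of subsequences\<close>

definition subsequential_limits :: "(nat \<Rightarrow> 'b::topological_space) \<Rightarrow> 'b set" where
  "subsequential_limits a = {v. \<exists>r :: nat \<Rightarrow> nat. strict_mono r \<and> (\<lambda>i. a (r i)) \<longlonglongrightarrow> v}"

lemma subsequential_limits_iff:
  fixes a :: "nat \<Rightarrow> 'b::metric_space"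
  shows "v \<in> subsequential_limits a \<longleftrightarrow> (\<forall>e>0. \<forall>N. \<exists>n\<ge>N. dist (a n) v < e)"
proof
  assume "v \<in> subsequential_limits a"
  then obtain r :: "nat \<Rightarrow> nat" where r: "strict_mono r" "(\<lambda>i. a (r i)) \<longlonglongrightarrow> v"
    by (auto simp: subsequential_limits_def)
  show "\<forall>e>0. \<forall>N. \<exists>n\<ge>N. dist (a n) v < e"
  proof (intro allI impI)
    fix e :: real and N :: nat
    assume "e > 0"
    then obtain M where M: "\<And>i. i \<ge> M \<Longrightarrow> dist (a (r i)) v < e"
      using r(2) unfolding lim_sequentially by blast
    have "N \<le> r (max M N)"
      using seq_suble[OF r(1), of "max M N"] by linarith
    then show "\<exists>n\<ge>N. dist (a n) v < e"
      using M[of "max M N"] by auto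
  qed
next
  assume near: "\<forall>e>0. \<forall>N. \<exists>n\<ge>N. dist (a n) v < e"
  have "\<exists>r. \<forall>n. dist (a (r n)) v < 1 / Suc n \<and> r n < r (Suc n)"
  proof (rule dependent_nat_choice)
    show "\<exists>x. dist (a x) v < 1 / Suc 0"
      using near[rule_format, of 1 0] by auto
    fix x n
    show "\<exists>y. dist (a y) v < 1 / Suc (Suc n) \<and> x < y"
      using near[rule_format, of "1 / Suc (Suc n)" "Suc x"] by auto
  qed
  then obtain r where r: "\<And>n. dist (a (r n)) v < 1 / Suc n" "\<And>n. r n < r (Suc n)"
    by blast
  have "(\<lambda>n. dist (a (r n)) v) \<longlonglongrightarrow> 0"
  proof (rule tendsto_sandwich[of "\<lambda>_. 0" _ _ "\<lambda>n. 1 / Suc n"])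
    show "(\<lambda>n. 1 / real (Suc n)) \<longlonglongrightarrow> 0"
      by (rule lim_1_over_n[THEN LIMSEQ_Suc])
  qed (use r(1) in \<open>auto intro!: always_eventually less_imp_le simp del: of_nat_Suc\<close>)
  then show "v \<in> subsequential_limits a"
    unfolding subsequential_limits_def
    using r(2) strict_mono_Suc_iff tendsto_dist_iff by blast
qed

lemma closed_subsequential_limits:
  fixes a :: "nat \<Rightarrow> 'b::metric_space"
  shows "closed (subsequential_limits a)"
  unfolding closure_subset_eq[symmetric]
proof
  fix v
  assume v: "v \<in> closure (subsequential_limits a)"
  show "v \<in> subsequential_limits a"
    unfolding subsequential_limits_iff
  proof (intro allI impI)
    fix e :: real and N :: nat
    assume "e > 0"
    then obtain w where w: "w \<in> subsequential_limits a" "dist w v < e / 2"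
      using v unfolding closure_approachable by (meson half_gt_zero)
    then obtain n where "n \<ge> N" "dist (a n) w < e / 2"
      using \<open>e > 0\<close> unfolding subsequential_limits_iff by (meson half_gt_zero)
    then show "\<exists>n\<ge>N. dist (a n) v < e"
      using w(2) dist_triangle_half_r[of w "a n" e v] dist_commute by metis
  qed
qed

lemma frequent_subsequence_limit:
  fixes a :: "nat \<Rightarrow> 'b::heine_borel"
  assumes "bounded (range a)" and freq: "\<And>N. \<exists>n\<ge>N. P n"
  obtains r :: "nat \<Rightarrow> nat" and v where "strict_mono r" "\<And>i. P (r i)" "(\<lambda>i. a (r i)) \<longlonglongrightarrow> v"
proof -
  have "infinite {n. P n}"
    using freq unfolding infinite_nat_iff_unbounded_le by auto
  then obtain s :: "nat \<Rightarrow> nat" where s: "strict_mono s" "\<And>i. P (s i)"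
    using infinite_enumerate[of "{n. P n}"] by auto
  have "bounded (range (\<lambda>i. a (s i)))"
    using assms(1) by (rule bounded_subset) auto
  then obtain t v where t: "strict_mono t" "((\<lambda>i. a (s i)) \<circ> t) \<longlonglongrightarrow> v"
    using bounded_imp_convergent_subsequence by blast
  show thesis
  proof (rule that)
    show "strict_mono (s \<circ> t)" using s t by (simp add: strict_mono_o)
  qed (use s t in \<open>auto simp: o_def\<close>)
qed

lemma subsequential_limits_nonempty:
  fixes a :: "nat \<Rightarrow> 'b::heine_borel"
  assumes "bounded (range a)"
  shows "subsequential_limits a \<noteq> {}"
  using frequent_subsequence_limit[OF assms, of "\<lambda>_. True"]
  unfolding subsequential_limits_def by blast

lemma unique_subsequential_limit_imp_tendsto:
  fixes a :: "nat \<Rightarrow> 'b::heine_borel"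
  assumes "bounded (range a)" and "subsequential_limits a = {v}"
  shows "a \<longlonglongrightarrow> v"
proof (rule ccontr)
  assume "\<not> a \<longlonglongrightarrow> v"
  then obtain e where e: "e > 0" "\<And>N. \<exists>n\<ge>N. dist (a n) v \<ge> e"
    unfolding lim_sequentially by (auto simp: not_less)
  obtain r w where r: "strict_mono r" "\<And>i. dist (a (r i)) v \<ge> e" "(\<lambda>i. a (r i)) \<longlonglongrightarrow> w"
    using frequent_subsequence_limit[OF assms(1), of "\<lambda>n. dist (a n) v \<ge> e"] e(2) by blast
  then have "w = v"
    using assms(2) by (auto simp: subsequential_limits_def)
  with r(3) e(1) obtain M where "dist (a (r M)) v < e"
    unfolding lim_sequentially by blast
  then show False using r(2)[of M] by simp
qed

text \<open>
  If the limits split into disjoint nonempty closed sets \<open>A\<close> and \<open>B\<close>, the difference of the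
  distances to \<open>A\<close> and to \<open>B\<close> changes sign along the sequence infinitely often. As the steps
  tend to zero, the sequence accumulates at a point equidistant from \<open>A\<close> and \<open>B\<close>, which can
  belong to neither.
\<close>

lemma connected_subsequential_limits:
  fixes a :: "nat \<Rightarrow> 'b::{real_normed_vector, heine_borel}"
  assumes bdd: "bounded (range a)" and steps: "(\<lambda>n. a (Suc n) - a n) \<longlonglongrightarrow> 0"
  shows "connected (subsequential_limits a)"
  unfolding connected_closed_set[OF closed_subsequential_limits]
proof
  assume "\<exists>A B. closed A \<and> closed B \<and> A \<noteq> {} \<and> B \<noteq> {} \<and>
    A \<union> B = subsequential_limits a \<and> A \<inter> B = {}"
  then obtain A B where AB: "closed A" "closed B" "A \<noteq> {}" "B \<noteq> {}"
    "A \<union> B = subsequential_limits a" "A \<inter> B = {}"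
    by blast
  define g where "g v = infdist v A - infdist v B" for v
  have g_cont: "(\<lambda>i. g (b i)) \<longlonglongrightarrow> g v" if "b \<longlonglongrightarrow> v" for b :: "nat \<Rightarrow> 'b" and v
    unfolding g_def using that by (intro tendsto_intros)
  have gA: "g v < 0" if "v \<in> A" for v
    using that AB infdist_pos_not_in_closed[of B v] by (auto simp: g_def)
  have gB: "g v > 0" if "v \<in> B" for v
    using that AB infdist_pos_not_in_closed[of A v] by (auto simp: g_def)
  have freq_neg: "\<exists>n\<ge>N. g (a n) < 0" for N
  proof -
    obtain v where v: "v \<in> A" using AB by blast
    then obtain r :: "nat \<Rightarrow> nat" where r: "strict_mono r" "(\<lambda>i. a (r i)) \<longlonglongrightarrow> v"
      using AB(5) unfolding subsequential_limits_def by blast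
    have "eventually (\<lambda>i. g (a (r i)) < 0) sequentially"
      using g_cont[OF r(2)] gA[OF v] by (rule order_tendstoD)
    then obtain M where "\<And>i. i \<ge> M \<Longrightarrow> g (a (r i)) < 0"
      unfolding eventually_sequentially by blast
    then show ?thesis
      using seq_suble[OF r(1), of "max M N"] by (meson max.bounded_iff order_refl)
  qed
  have freq_pos: "\<exists>n\<ge>N. g (a n) > 0" for N
  proof -
    obtain v where v: "v \<in> B" using AB by blast
    then obtain r :: "nat \<Rightarrow> nat" where r: "strict_mono r" "(\<lambda>i. a (r i)) \<longlonglongrightarrow> v"
      using AB(5) unfolding subsequential_limits_def by blast
    have "eventually (\<lambda>i. g (a (r i)) > 0) sequentially"
      using g_cont[OF r(2)] gB[OF v] by (rule order_tendstoD)
    then obtain M where "\<And>i. i \<ge> M \<Longrightarrow> g (a (r i)) > 0"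
      unfolding eventually_sequentially by blast
    then show ?thesis
      using seq_suble[OF r(1), of "max M N"] by (meson max.bounded_iff order_refl)
  qed
  have sign_change: "\<exists>n\<ge>N. g (a n) \<le> 0 \<and> g (a (Suc n)) \<ge> 0" for N
  proof (rule ccontr)
    assume no_change: "\<not> ?thesis"
    obtain n where n: "n \<ge> N" "g (a n) < 0" using freq_neg by blast
    have "g (a k) < 0" if "k \<ge> n" for k
      using that
    proof (induction k rule: dec_induct)
      case base
      show ?case by (rule n)
    next
      case (step k)
      then have "N \<le> k" using n by linarith
      with step no_change show ?case by (meson less_imp_le not_less)
    qed
    then show False using freq_pos[of n] by (meson less_asym)
  qed
  obtain r w where r: "strict_mono r" "\<And>i. g (a (r i)) \<le> 0 \<and> g (a (Suc (r i))) \<ge> 0"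
    "(\<lambda>i. a (r i)) \<longlonglongrightarrow> w"
    using frequent_subsequence_limit[OF bdd, of "\<lambda>n. g (a n) \<le> 0 \<and> g (a (Suc n)) \<ge> 0"]
      sign_change by blast
  have "(\<lambda>i. (a (Suc (r i)) - a (r i)) + a (r i)) \<longlonglongrightarrow> 0 + w"
    using LIMSEQ_subseq_LIMSEQ[OF steps r(1)] r(3) by (intro tendsto_add) (auto simp: o_def)
  then have w_Suc: "(\<lambda>i. a (Suc (r i))) \<longlonglongrightarrow> w" by simp
  have "g w \<le> 0" "g w \<ge> 0"
    using LIMSEQ_le_const2[OF g_cont[OF r(3)], of 0] LIMSEQ_le_const[OF g_cont[OF w_Suc], of 0] r(2)
    by auto
  moreover have "w \<in> A \<union> B"
    using r AB(5) unfolding subsequential_limits_def by blast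
  ultimately show False using gA[of w] gB[of w] by auto
qed

section \<open>Birkhoff averages\<close>

lemma accumulation_vectors_eq:
  "accumulation_vectors f \<phi> x = subsequential_limits (\<lambda>n. birkhoff_average f \<phi> n x)"
  by (simp add: accumulation_vectors_def subsequential_limits_def)

lemma funpow_mem:
  assumes "f ` X \<subseteq> X" "x \<in> X"
  shows "(f ^^ n) x \<in> X"
  using assms by (induction n) auto

lemma continuous_on_birkhoff_average:
  fixes \<phi> :: "'a::topological_space \<Rightarrow> 'b::real_normed_vector"
  assumes "continuous_on X f" and inv: "f ` X \<subseteq> X" and "continuous_on X \<phi>"
  shows "continuous_on X (birkhoff_average f \<phi> n)"
proof -
  have iter: "continuous_on X (f ^^ j)" for j
  proof (induction j)
    case 0
    show ?case by (simp add: id_def)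
  next
    case (Suc j)
    have "continuous_on ((f ^^ j) ` X) f"
      using assms(1) by (rule continuous_on_subset) (use funpow_mem[OF inv] in auto)
    with Suc show ?case using continuous_on_compose[of X "f ^^ j" f] by simp
  qed
  have "continuous_on X (\<lambda>x. \<phi> ((f ^^ j) x))" for j
    by (rule continuous_on_compose2[OF assms(3) iter]) (use funpow_mem[OF inv] in auto)
  then have "continuous_on X (\<lambda>x. (1 / real n) *\<^sub>R (\<Sum>j<n. \<phi> ((f ^^ j) x)))"
    by (intro continuous_intros)
  then show ?thesis by (simp add: birkhoff_average_def[abs_def])
qed

lemma norm_average_le:
  fixes u :: "nat \<Rightarrow> 'b::real_normed_vector"
  assumes "\<And>j. j < n \<Longrightarrow> norm (u j) \<le> C" "0 \<le> C"
  shows "norm ((1 / real n) *\<^sub>R (\<Sum>j<n. u j)) \<le> C"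
proof (cases "n = 0")
  case False
  have "norm (\<Sum>j<n. u j) \<le> real n * C"
    using sum_norm_bound[of "{..<n}" u C] assms by auto
  with False show ?thesis by (simp add: field_simps)
qed (use assms in auto)

lemma norm_birkhoff_average_le:
  fixes \<phi> :: "'a \<Rightarrow> 'b::real_normed_vector"
  assumes "f ` X \<subseteq> X" and "\<And>z. z \<in> X \<Longrightarrow> norm (\<phi> z) \<le> C" and "x \<in> X"
  shows "norm (birkhoff_average f \<phi> n x) \<le> C"
  unfolding birkhoff_average_def
proof (rule norm_average_le)
  show "0 \<le> C" using assms(2)[OF assms(3)] norm_ge_zero order_trans by blast
qed (rule assms(2)[OF funpow_mem[OF assms(1,3)]])

lemma birkhoff_average_steps:
  fixes \<phi> :: "'a \<Rightarrow> 'b::real_normed_vector"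
  assumes "f ` X \<subseteq> X" and bd: "\<And>z. z \<in> X \<Longrightarrow> norm (\<phi> z) \<le> C" and "x \<in> X"
  shows "(\<lambda>n. birkhoff_average f \<phi> (Suc n) x - birkhoff_average f \<phi> n x) \<longlonglongrightarrow> 0"
proof (rule Lim_null_comparison)
  let ?A = "\<lambda>n. birkhoff_average f \<phi> n x"
  show "(\<lambda>n. (2 * C) * (1 / real (Suc n))) \<longlonglongrightarrow> 0"
    using tendsto_mult_right_zero[OF lim_1_over_n[THEN LIMSEQ_Suc], of "2 * C"] by simp
  show "eventually (\<lambda>n. norm (?A (Suc n) - ?A n) \<le> (2 * C) * (1 / real (Suc n))) sequentially"
  proof (rule always_eventually, rule allI)
    fix n
    have sum_eq: "real k *\<^sub>R ?A k = (\<Sum>j<k. \<phi> ((f ^^ j) x))" for k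
      by (cases "k = 0") (auto simp: birkhoff_average_def)
    have "real (Suc n) *\<^sub>R (?A (Suc n) - ?A n) = \<phi> ((f ^^ n) x) - ?A n"
      unfolding scaleR_diff_right sum_eq by (simp add: scaleR_add_left sum_eq)
    then have "real (Suc n) * norm (?A (Suc n) - ?A n) = norm (\<phi> ((f ^^ n) x) - ?A n)"
      by (metis abs_of_nat norm_scaleR)
    also have "\<dots> \<le> 2 * C"
      using norm_triangle_ineq4[of "\<phi> ((f ^^ n) x)" "?A n"] bd[OF funpow_mem[OF assms(1,3)], of n]
        norm_birkhoff_average_le[of f X \<phi> C x n] assms by auto
    finally show "norm (?A (Suc n) - ?A n) \<le> (2 * C) * (1 / real (Suc n))"
      by (simp add: field_simps del: of_nat_Suc)
  qed
qed

lemma birkhoff_average_shift: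
  fixes \<phi> :: "'a \<Rightarrow> 'b::real_normed_vector"
  assumes inv: "f ` X \<subseteq> X" and bd: "\<And>z. z \<in> X \<Longrightarrow> norm (\<phi> z) \<le> C" and "x \<in> X"
  shows "dist (birkhoff_average f \<phi> n x) (birkhoff_average f \<phi> n ((f ^^ q) x))
    \<le> 2 * C * real q / real n"
proof (induction q)
  case (Suc q)
  define z where "z = (f ^^ q) x"
  have z: "z \<in> X" using funpow_mem[OF inv assms(3)] by (simp add: z_def)
  have "birkhoff_average f \<phi> n z - birkhoff_average f \<phi> n (f z)
      = (1 / real n) *\<^sub>R ((\<Sum>j<n. \<phi> ((f ^^ j) z)) - (\<Sum>j<n. \<phi> ((f ^^ Suc j) z)))"
    by (simp add: birkhoff_average_def scaleR_diff_right funpow_swap1)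
  also have "(\<Sum>j<n. \<phi> ((f ^^ j) z)) - (\<Sum>j<n. \<phi> ((f ^^ Suc j) z)) = \<phi> z - \<phi> ((f ^^ n) z)"
    using sum_lessThan_telescope'[of "\<lambda>j. \<phi> ((f ^^ j) z)" n] by (simp add: sum_subtractf)
  finally have "dist (birkhoff_average f \<phi> n z) (birkhoff_average f \<phi> n (f z))
      = norm (\<phi> z - \<phi> ((f ^^ n) z)) / real n"
    by (simp add: dist_norm)
  also have "\<dots> \<le> 2 * C / real n"
    using norm_triangle_ineq4[of "\<phi> z" "\<phi> ((f ^^ n) z)"] bd[OF z] bd[OF funpow_mem[OF inv z], of n]
    by (intro divide_right_mono) auto
  finally have "dist (birkhoff_average f \<phi> n z) (birkhoff_average f \<phi> n (f z)) \<le> 2 * C / real n" .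
  with Suc have "dist (birkhoff_average f \<phi> n x) (birkhoff_average f \<phi> n (f z))
      \<le> 2 * C * real q / real n + 2 * C / real n"
    unfolding z_def by (meson add_mono dist_triangle order_trans)
  then show ?case by (simp add: z_def add_divide_distrib algebra_simps)
qed simp

section \<open>Genericity of full accumulation\<close>

text \<open>
  Two orbit pieces are all that genericity requires: a short one that prescribes the position and
  a long one that prescribes the average.
\<close>

lemma gluing_pairD:
  assumes "gluing_orbit_property X f" and "\<epsilon> > 0"
  obtains m where "\<And>z x k n. z \<in> X \<Longrightarrow> x \<in> X \<Longrightarrow> k \<ge> 1 \<Longrightarrow> n \<ge> 1 \<Longrightarrow>
    \<exists>p\<le>m. \<exists>y\<in>X. (\<forall>j\<le>k. dist ((f ^^ j) y) ((f ^^ j) z) \<le> \<epsilon>) \<and>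
      (\<forall>j\<le>n. dist ((f ^^ (j + (k + p))) y) ((f ^^ j) x) \<le> \<epsilon>)"
proof -
  obtain m :: nat where "m \<ge> 1 \<and>
      (\<forall>(k::nat) (x :: nat \<Rightarrow> 'a) (n :: nat \<Rightarrow> nat).
        k \<ge> 1 \<longrightarrow> (\<forall>i\<in>{1..k}. x i \<in> X \<and> n i \<ge> 1) \<longrightarrow>
        (\<exists>(p :: nat \<Rightarrow> nat) y. (\<forall>i\<in>{1..<k}. p i \<le> m) \<and> y \<in> X \<and>
          (\<forall>j\<le>n 1. dist ((f ^^ j) y) ((f ^^ j) (x 1)) \<le> \<epsilon>) \<and>
          (\<forall>i\<in>{2..k}. \<forall>j\<le>n i.
            dist ((f ^^ (j + (\<Sum>l\<in>{1..<i}. n l + p l))) y) ((f ^^ j) (x i)) \<le> \<epsilon>)))"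
    using assms(1)[unfolded gluing_orbit_property_def, THEN spec, THEN mp, OF assms(2)]
    by (rule exE)
  note m = this[THEN conjunct2, THEN spec, THEN spec, THEN spec, THEN mp, THEN mp]
  show thesis
  proof (rule that[of m])
    fix z x :: 'a and k n :: nat
    assume zx: "z \<in> X" "x \<in> X" "k \<ge> 1" "n \<ge> 1"
    let ?x = "\<lambda>i::nat. if i = 1 then z else x" and ?n = "\<lambda>i::nat. if i = 1 then k else n"
    have valid: "\<forall>i\<in>{1..2}. ?x i \<in> X \<and> ?n i \<ge> 1" using zx by simp
    obtain p y where "\<forall>i\<in>{1..<2}. p i \<le> m" and y: "y \<in> X"
      and "\<forall>j\<le>?n 1. dist ((f ^^ j) y) ((f ^^ j) (?x 1)) \<le> \<epsilon>"
      and tail: "\<forall>i\<in>{2..2}. \<forall>j\<le>?n i.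
        dist ((f ^^ (j + (\<Sum>l\<in>{1..<i}. ?n l + p l))) y) ((f ^^ j) (?x i)) \<le> \<epsilon>"
      using m[OF one_le_numeral valid] by (elim exE conjE) (rule that)
    moreover have "(\<Sum>l\<in>{1..<2}. ?n l + p l) = k + p 1"
      by (simp add: numeral_2_eq_2)
    ultimately show "\<exists>p\<le>m. \<exists>y\<in>X. (\<forall>j\<le>k. dist ((f ^^ j) y) ((f ^^ j) z) \<le> \<epsilon>) \<and>
      (\<forall>j\<le>n. dist ((f ^^ (j + (k + p))) y) ((f ^^ j) x) \<le> \<epsilon>)"
      by (intro exI[of _ "p 1"] conjI bexI[of _ y]) auto
  qed
qed

text \<open>
  The three contributions to the error are the distance of the average of \<open>x\<close> from \<open>v\<close>, the
  quality of the shadowing, and the at most \<open>m + 1\<close> steps that precede the shadowing; the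
  last is negligible because \<open>m\<close> is fixed before the time \<open>n\<close>.
\<close>

lemma gluing_approximates_accumulation_vector:
  fixes X :: "'a::metric_space set" and \<phi> :: "'a \<Rightarrow> 'b::real_normed_vector"
  assumes "compact X" and inv: "f ` X \<subseteq> X" and glue: "gluing_orbit_property X f"
    and cont: "continuous_on X \<phi>" and x: "x \<in> X" and v: "v \<in> accumulation_vectors f \<phi> x"
    and z: "z \<in> X" and "\<delta> > 0" and "e > 0"
  shows "\<exists>y\<in>X. dist y z < \<delta> \<and> (\<exists>n\<ge>N. dist (birkhoff_average f \<phi> n y) v < e)"
proof -
  let ?A = "birkhoff_average f \<phi>"
  obtain C where C: "\<And>z. z \<in> X \<Longrightarrow> norm (\<phi> z) \<le> C"
    using compact_imp_bounded[OF compact_continuous_image[OF cont assms(1)]]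
    unfolding bounded_iff by auto
  then have "C \<ge> 0" using x norm_ge_zero order_trans by blast
  have "uniformly_continuous_on X \<phi>"
    using compact_uniformly_continuous[OF cont assms(1)] .
  then obtain \<eta> where \<eta>: "\<eta> > 0"
    "\<And>s t. s \<in> X \<Longrightarrow> t \<in> X \<Longrightarrow> dist s t < \<eta> \<Longrightarrow> dist (\<phi> s) (\<phi> t) < e / 3"
    using \<open>e > 0\<close> unfolding uniformly_continuous_on_def
    by (metis dist_commute divide_pos_pos zero_less_numeral)
  define \<epsilon> where "\<epsilon> = min \<delta> \<eta> / 2"
  have \<epsilon>: "\<epsilon> > 0" "\<epsilon> < \<delta>" "\<epsilon> < \<eta>"
    using \<open>\<delta> > 0\<close> \<eta>(1) by (auto simp: \<epsilon>_def min_def)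
  obtain m where m: "\<And>z x k n. z \<in> X \<Longrightarrow> x \<in> X \<Longrightarrow> k \<ge> 1 \<Longrightarrow> n \<ge> 1 \<Longrightarrow>
    \<exists>p\<le>m. \<exists>y\<in>X. (\<forall>j\<le>k. dist ((f ^^ j) y) ((f ^^ j) z) \<le> \<epsilon>) \<and>
      (\<forall>j\<le>n. dist ((f ^^ (j + (k + p))) y) ((f ^^ j) x) \<le> \<epsilon>)"
    using gluing_pairD[OF glue \<epsilon>(1)] by blast
  \<comment> \<open>From time \<open>L\<close> on, the cost \<open>2 * C * (m + 1) / n\<close> of the prefix is below \<open>e / 3\<close>.\<close>
  obtain L :: nat where L: "6 * C * real (1 + m) / e < real L"
    using reals_Archimedean2 by blast
  obtain n where n: "n \<ge> max N (Suc L)" "dist (?A n x) v < e / 3"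
    using v \<open>e > 0\<close> unfolding accumulation_vectors_eq subsequential_limits_iff
    by (meson divide_pos_pos zero_less_numeral)
  obtain p y where p: "p \<le> m" and y: "y \<in> X"
    and head: "\<forall>j\<le>1. dist ((f ^^ j) y) ((f ^^ j) z) \<le> \<epsilon>"
    and tail: "\<forall>j\<le>n. dist ((f ^^ (j + (1 + p))) y) ((f ^^ j) x) \<le> \<epsilon>"
    using m[OF z x, of 1 n] n(1) by auto
  define q where "q = 1 + p"
  have "dist y z \<le> \<epsilon>" using head[rule_format, of 0] by simp
  then have near: "dist y z < \<delta>" using \<epsilon> by linarith
  have shadow: "dist (?A n ((f ^^ q) y)) (?A n x) \<le> e / 3"
  proof -
    have "?A n ((f ^^ q) y) - ?A n x =
        (1 / real n) *\<^sub>R (\<Sum>j<n. \<phi> ((f ^^ j) ((f ^^ q) y)) - \<phi> ((f ^^ j) x))"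
      by (simp add: birkhoff_average_def sum_subtractf scaleR_diff_right)
    also have "norm \<dots> \<le> e / 3"
    proof (rule norm_average_le)
      fix j assume "j < n"
      then have "dist ((f ^^ (j + q)) y) ((f ^^ j) x) \<le> \<epsilon>"
        using tail by (simp only: q_def less_imp_le)
      then have "dist ((f ^^ j) ((f ^^ q) y)) ((f ^^ j) x) < \<eta>"
        using \<epsilon> by (simp add: funpow_add)
      then show "norm (\<phi> ((f ^^ j) ((f ^^ q) y)) - \<phi> ((f ^^ j) x)) \<le> e / 3"
        unfolding dist_norm[symmetric]
        by (intro less_imp_le \<eta>(2)) (use funpow_mem[OF inv] x y in auto)
    qed (use \<open>e > 0\<close> in auto)
    finally show ?thesis by (simp add: dist_norm)
  qed
  have gap: "dist (?A n y) (?A n ((f ^^ q) y)) < e / 3"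
  proof -
    have "dist (?A n y) (?A n ((f ^^ q) y)) \<le> 2 * C * real q / real n"
      by (rule birkhoff_average_shift[OF inv C y])
    also have "\<dots> \<le> 2 * C * real (1 + m) / real n"
      using p \<open>C \<ge> 0\<close> by (intro divide_right_mono mult_left_mono) (auto simp: q_def)
    also have "\<dots> < e / 3"
    proof -
      have "6 * C * real (1 + m) < e * real L"
        using L \<open>e > 0\<close> by (simp add: field_simps)
      also have "\<dots> \<le> e * real n"
        using n(1) \<open>e > 0\<close> by (intro mult_left_mono) auto
      finally have "6 * C * real (1 + m) < e * real n" .
      moreover have "real n > 0" using n(1) by simp
      ultimately show ?thesis by (simp add: field_simps)
    qed
    finally show ?thesis .
  qed
  have "dist (?A n y) v < e"
    using gap shadow n(2) dist_triangle[of "?A n y" v "?A n ((f ^^ q) y)"]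
      dist_triangle[of "?A n ((f ^^ q) y)" v "?A n x"] by linarith
  then show ?thesis using y near n(1) by auto
qed

lemma baire_residual_Inter:
  assumes "countable \<U>" "\<U> \<noteq> {}"
    and "\<And>U. U \<in> \<U> \<Longrightarrow> openin (top_of_set X) U \<and> X \<subseteq> closure U"
    and "\<Inter>\<U> \<subseteq> R" "R \<subseteq> X"
  shows "baire_residual X R"
  unfolding baire_residual_def
proof (intro conjI exI[of _ "from_nat_into \<U>"] allI)
  show "(\<Inter>n. from_nat_into \<U> n) \<subseteq> R"
    using assms range_from_nat_into[of \<U>] by simp
qed (use assms from_nat_into[of \<U>] in auto)

lemma baire_residual_mono:
  "baire_residual X R \<Longrightarrow> R \<subseteq> S \<Longrightarrow> S \<subseteq> X \<Longrightarrow> baire_residual X S"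
  unfolding baire_residual_def by (meson order_trans)

lemma baire_residual_nonempty:
  fixes X :: "'a::metric_space set"
  assumes "baire_residual X R" and "compact X" and "X \<noteq> {}"
  shows "R \<noteq> {}"
proof -
  obtain U :: "nat \<Rightarrow> 'a set"
    where U: "\<And>n. openin (top_of_set X) (U n) \<and> X \<subseteq> closure (U n)" "(\<Inter>n. U n) \<subseteq> R"
    using assms(1) unfolding baire_residual_def by blast
  let ?X = "top_of_set X"
  have "?X closure_of \<Inter>(range U) = topspace ?X"
  proof (rule Baire_category)
    have "compact_space ?X" "Hausdorff_space ?X"
      using assms(2) by (auto intro: compact_space_subtopology Hausdorff_space_subtopology)
    then show "completely_metrizable_space ?X \<or> locally_compact_space ?X \<and> regular_space ?X"
      using compact_imp_locally_compact_space compact_Hausdorff_imp_regular_space by blast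
    fix T assume "T \<in> range U"
    then obtain n where n: "T = U n" by blast
    have "T \<subseteq> X" using U(1)[of n] n openin_imp_subset by blast
    then have "X \<inter> T = T" by blast
    then show "openin ?X T \<and> ?X closure_of T = topspace ?X"
      using U(1)[of n] n by (auto simp: closure_of_subtopology)
  qed simp
  then have "\<Inter>(range U) \<noteq> {}" using assms(3) by auto
  then show ?thesis using U(2) by auto
qed

text \<open>
  Countably many open dense conditions suffice, because the accumulation vectors of each point
  form a closed set.
\<close>

lemma residual_full_accumulation:
  fixes X :: "'a::metric_space set" and \<phi> :: "'a \<Rightarrow> 'b::{real_normed_vector, second_countable_topology}"
  assumes "compact X" and "continuous_on X f" and "f ` X \<subseteq> X"
    and "gluing_orbit_property X f" and "continuous_on X \<phi>"
  shows "baire_residual X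
    {x \<in> X. accumulation_vectors f \<phi> x = all_accumulation_vectors X f \<phi>}"
proof -
  let ?A = "birkhoff_average f \<phi>" and ?V = "all_accumulation_vectors X f \<phi>"
  define G where "G v k N = (\<Union>n\<in>{N..}. X \<inter> ?A n -` ball v (1 / real (Suc k)))" for v k N
  obtain T where T: "countable T" "T \<subseteq> ?V" "?V \<subseteq> closure T"
    using separable by blast
  \<comment> \<open>Adding \<open>X\<close> itself keeps the family nonempty when there are no accumulation vectors.\<close>
  let ?U = "insert X ((\<lambda>(v, k, N). G v k N) ` (T \<times> UNIV \<times> UNIV))"
  show ?thesis
  proof (rule baire_residual_Inter[of ?U])
    show "countable ?U" using T(1) by auto
    fix U assume U: "U \<in> ?U"
    have "openin (top_of_set X) (G v k N) \<and> X \<subseteq> closure (G v k N)" if "v \<in> T" for v k N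
    proof
      have "openin (top_of_set X) (X \<inter> ?A n -` ball v (1 / real (Suc k)))" for n
        by (rule continuous_openin_preimage_gen[OF continuous_on_birkhoff_average[OF assms(2,3,5)]
              open_ball])
      then show "openin (top_of_set X) (G v k N)"
        unfolding G_def by blast
      obtain x where x: "x \<in> X" "v \<in> accumulation_vectors f \<phi> x"
        using \<open>v \<in> T\<close> T(2) unfolding all_accumulation_vectors_def by blast
      show "X \<subseteq> closure (G v k N)"
      proof
        fix z assume "z \<in> X"
        have "\<exists>y\<in>G v k N. dist y z < \<delta>" if "\<delta> > 0" for \<delta>
        proof -
          have "0 < 1 / real (Suc k)" by simp
          from gluing_approximates_accumulation_vector[OF assms(1,3,4,5) x \<open>z \<in> X\<close> that this, of N]
          obtain y n where "y \<in> X" "dist y z < \<delta>" "n \<ge> N" "dist v (?A n y) < 1 / real (Suc k)"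
            by (auto simp only: dist_commute)
          then show ?thesis
            by (intro bexI[of _ y]) (auto simp: G_def simp del: of_nat_Suc)
        qed
        then show "z \<in> closure (G v k N)" by (simp add: closure_approachable)
      qed
    qed
    then show "openin (top_of_set X) U \<and> X \<subseteq> closure U"
      using U closure_subset[of X] by auto
  next
    show "\<Inter>?U \<subseteq> {x \<in> X. accumulation_vectors f \<phi> x = ?V}"
    proof
      fix y assume y: "y \<in> \<Inter>?U"
      then have "y \<in> X" by auto
      have yG: "y \<in> G v k N" if "v \<in> T" for v k N
        using y that by force
      have "T \<subseteq> accumulation_vectors f \<phi> y"
      proof
        fix v assume "v \<in> T"
        show "v \<in> accumulation_vectors f \<phi> y"
          unfolding accumulation_vectors_eq subsequential_limits_iff
        proof (intro allI impI)
          fix e :: real and N assume "e > 0"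
          then obtain k where k: "1 / real (Suc k) < e" using nat_approx_posE by blast
          show "\<exists>n\<ge>N. dist (?A n y) v < e"
          proof -
            obtain n where "n \<ge> N" "dist v (?A n y) < 1 / real (Suc k)"
              using yG[OF \<open>v \<in> T\<close>, of k N] unfolding G_def by auto
            then show ?thesis using k by (metis dist_commute less_trans)
          qed
        qed
      qed
      then have "closure T \<subseteq> accumulation_vectors f \<phi> y"
        unfolding accumulation_vectors_eq by (rule closure_minimal[OF _ closed_subsequential_limits])
      then show "y \<in> {x \<in> X. accumulation_vectors f \<phi> x = ?V}"
        using T(3) \<open>y \<in> X\<close> unfolding all_accumulation_vectors_def by blast
    qed
  qed auto
qed

theorem theorem4:
  fixes X :: "'a::metric_space set"
    and f :: "'a \<Rightarrow> 'a"
    and \<phi> :: "'a \<Rightarrow> real ^ 'd"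
  assumes "compact X"
    and "continuous_on X f" and "f ` X \<subseteq> X"
    and "gluing_orbit_property X f"
    and "continuous_on X \<phi>"
  shows "((\<exists>v. \<forall>x\<in>X. (\<lambda>n. birkhoff_average f \<phi> n x) \<longlonglongrightarrow> v) \<or>
          baire_residual X (historic_points X f \<phi>)) \<and>
         (historic_points X f \<phi> \<noteq> {} \<longrightarrow>
          connected (all_accumulation_vectors X f \<phi>) \<and>
          baire_residual X (wild_historic_points X f \<phi>))"
proof -
  let ?V = "all_accumulation_vectors X f \<phi>"
  let ?R = "{x \<in> X. accumulation_vectors f \<phi> x = ?V}"
  have residual: "baire_residual X ?R"
    by (rule residual_full_accumulation[OF assms])
  obtain C where C: "\<And>z. z \<in> X \<Longrightarrow> norm (\<phi> z) \<le> C"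
    using compact_imp_bounded[OF compact_continuous_image[OF assms(5,1)]]
    unfolding bounded_iff by auto
  have bdd: "bounded (range (\<lambda>n. birkhoff_average f \<phi> n x))" if "x \<in> X" for x
    unfolding bounded_iff using norm_birkhoff_average_le[OF assms(3) _ that] C by blast
  have connected: "connected (accumulation_vectors f \<phi> x)" if "x \<in> X" for x
    unfolding accumulation_vectors_eq
    by (rule connected_subsequential_limits[OF bdd[OF that]
          birkhoff_average_steps[OF assms(3) C that]])
  have nonempty: "accumulation_vectors f \<phi> x \<noteq> {}" if "x \<in> X" for x
    unfolding accumulation_vectors_eq by (rule subsequential_limits_nonempty[OF bdd[OF that]])
  have sub: "accumulation_vectors f \<phi> x \<subseteq> ?V" if "x \<in> X" for x
    using that unfolding all_accumulation_vectors_def by blast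
  have connected_all: "connected ?V"
  proof (cases "X = {}")
    case True
    then show ?thesis by (simp add: all_accumulation_vectors_def)
  next
    case False
    then obtain x where "x \<in> X" "accumulation_vectors f \<phi> x = ?V"
      using baire_residual_nonempty[OF residual assms(1)] by auto
    then show ?thesis using connected by metis
  qed
  show ?thesis
  proof (cases "trivial_set ?V")
    case True
    then obtain v where "?V = {v}" unfolding trivial_set_def by blast
    then have acc: "accumulation_vectors f \<phi> x = {v}" if "x \<in> X" for x
      using sub[OF that] nonempty[OF that] by auto
    then have "(\<lambda>n. birkhoff_average f \<phi> n x) \<longlonglongrightarrow> v" if "x \<in> X" for x
      using unique_subsequential_limit_imp_tendsto[OF bdd[OF that]] that
      by (simp add: accumulation_vectors_eq)
    moreover have "historic_points X f \<phi> = {}"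
      using acc by (auto simp: historic_points_def trivial_set_def)
    ultimately show ?thesis by auto
  next
    case False
    then have "wild_historic_points X f \<phi> = ?R"
      by (auto simp: wild_historic_points_def)
    moreover have "baire_residual X (historic_points X f \<phi>)"
      using residual by (rule baire_residual_mono)
        (use False connected in \<open>auto simp: historic_points_def\<close>)
    ultimately show ?thesis using residual connected_all by auto
  qed
qed

end
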